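(* On rooted plane trees, the map $M$ given by the recursion $$M([\,])=[\,],\qquad M([c_1,\dots,c_k])=M(c_1)\oplus\lambda\bigl(M([c_2,\dots,c_k])\bigr)\quad(k\ge 1)$$ coincides with Donaghey's automorphism $L^{-1}\circ R$ on plane trees.
   Context: A rooted plane tree is represented as the list $[c_1,\dots,c_k]$ of the subtrees hanging from its root; the single-node tree is $e=[\,]$. Operations: $\lambda(T)=[T]$ (new root with $T$ as sole child) and $\oplus$ concatenates the child lists of the two roots, so $[c_1,\dots,c_k]=\lambda(c_1)\oplus\cdots\oplus\lambda(c_k)$. Donaghey's automorphism is $L^{-1}\circ R$, where $R$ and $L$ are maps from "general bracketings" to "plus-binary bracketings". A general bracketing is identified with a plane tree in the usual way, and $[c_1,\dots,c_k]$ represents $\lambda(c_1)\oplus\cdots\oplus\lambda(c_k)$. A plus-binary bracketing is represented as a (possibly empty) list $[b_1,\dots,b_k]$, each $b_i$ itself a plus-binary bracketing. The map $R$ sends the general bracketing $[c_1,\dots,c_k]$ to the plus-binary bracketing $[R(c_1),\dots,R(c_k)]$ (with $R([\,])=[\,]$). The map $L^{-1}$ converts a plus-binary bracketing to a general bracketing (plane tree) by decoding it, recursively, in right-nested fashion: $L^{-1}([\,])=e$ and $$L^{-1}([b_1,\dots,b_k])=L^{-1}(b_1)\oplus\lambda\bigl(L^{-1}(b_2)\oplus\lambda(\cdots\oplus\lambda(L^{-1}(b_k)\oplus\lambda(e))\cdots)\bigr).$$ *)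

theory Defs
  imports Main
begin

datatype plane_tree = Node "plane_tree list"

primrec children :: "plane_tree \<Rightarrow> plane_tree list" where
  "children (Node cs) = cs"

definition single_node :: plane_tree where
  "single_node = Node []"

definition lam :: "plane_tree \<Rightarrow> plane_tree" where
  "lam T = Node [T]"

definition oplus :: "plane_tree \<Rightarrow> plane_tree \<Rightarrow> plane_tree"  (infixr "\<oplus>" 65) where
  "S \<oplus> T = Node (children S @ children T)"

text \<open>
  A general bracketing is identified with the plane tree it describes:
  \<open>Node [c\<^sub>1, \<dots>, c\<^sub>k]\<close> stands for \<open>lam c\<^sub>1 \<oplus> \<dots> \<oplus> lam c\<^sub>k\<close>.
\<close>

type_synonym general_bracketing = plane_tree

text \<open>
  Plus-binary bracketings have the same shape as plane trees, but are kept as a separate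
  type because they are decoded differently.
\<close>

datatype plus_binary = Bracket "plus_binary list"

fun R_map :: "general_bracketing \<Rightarrow> plus_binary" where
  "R_map (Node cs) = Bracket (map R_map cs)"

text \<open>
  The right fold is the nested expression
  \<open>L_inv b\<^sub>1 \<oplus> lam (L_inv b\<^sub>2 \<oplus> lam (\<dots> \<oplus> lam (L_inv b\<^sub>k \<oplus> lam e) \<dots>))\<close>
  with \<open>e = single_node\<close>; for \<open>k = 0\<close> it is \<open>e\<close>. This decoding is what specifies
  the inverse of the map \<open>L\<close>; \<open>L\<close> itself is not used.
\<close>

fun L_inv :: "plus_binary \<Rightarrow> general_bracketing" where
  "L_inv (Bracket bs) = foldr (\<lambda>b T. L_inv b \<oplus> lam T) bs single_node"

definition donaghey :: "plane_tree \<Rightarrow> plane_tree" where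
  "donaghey = L_inv \<circ> R_map"

fun M_map :: "plane_tree \<Rightarrow> plane_tree" where
  "M_map (Node []) = Node []"
| "M_map (Node (c # cs)) = M_map c \<oplus> lam (M_map (Node cs))"

end

theory Submission
  imports Defs
begin

text \<open>Peeling the outermost layer off the right-nested decoding of
  \<open>R_map (Node (c # cs))\<close> leaves, under \<open>lam\<close>, the decoding of
  \<open>R_map (Node cs)\<close>. This is the recursion of \<open>M_map\<close>, and the empty fold
  gives its base value.\<close>

lemma M_map_eq_L_inv_R_map: "M_map T = L_inv (R_map T)"
  \<comment> \<open>This rule gives hypotheses for both the first child \<open>c\<close> and the
    shortened tree \<open>Node cs\<close>; the latter is not a subtree of
    \<open>Node (c # cs)\<close>, so structural induction would not supply it directly.\<close>
  by (induction T rule: M_map.induct) (simp_all add: single_node_def)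

theorem theorem5p8:
  shows "M_map = donaghey"
  by (simp add: fun_eq_iff donaghey_def M_map_eq_L_inv_R_map)

end
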